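(* Let $\mathcal{G}$ be a connected, undirected graph on $n$ nodes, let $K=\mathrm{diag}(k_1,\ldots,k_n)$ with all $k_i>0$, let $m>0$, and set $M=m\mathrm{I}_n$, $\tilde A=-\mathcal{L}(\mathcal{G})-M$ and $\mathcal{Q}(\mathcal{G})=\mathrm{I}_n-\mathcal{S}(\mathcal{G})(\mathrm{I}_n+\mathcal{A}(\mathcal{G}))$. Consider the error system $$\dot e(t)=\tilde A_0\, e(t),\qquad e(0)=e_0,\qquad \tilde A_0=\begin{bmatrix}\tilde A & -\mathrm{I}_n\\ K\mathcal{Q}(\mathcal{G}) & 0_{n\times n}\end{bmatrix},\qquad t\ge 0.$$ Then the solution $e(t)$ is Lyapunov stable for all $e_0\in\mathbb{R}^{2n}$ and $t\ge 0$, and for every $e_0\in\mathbb{R}^{2n}$ there is a constant $\epsilon\in\mathbb{R}$ such that $$e(t)\to \epsilon\,\bigl[\mathbf{1}_n^{\mathrm T},\ -m\mathbf{1}_n^{\mathrm T}\bigr]^{\mathrm T}\quad\text{as } t\to\infty .$$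
   Context: The graph $\mathcal{G}$ is static, with nodes $\{1,\ldots,n\}$ and unweighted edges; $N_i$ is the number of neighbors of node $i$. $\mathcal{A}(\mathcal{G})$ is the $0$–$1$ adjacency matrix, $\mathcal{D}(\mathcal{G})=\mathrm{diag}(N_1,\ldots,N_n)$ the degree matrix, $\mathcal{L}(\mathcal{G})=\mathcal{D}(\mathcal{G})-\mathcal{A}(\mathcal{G})$ the Laplacian, and $\mathcal{S}(\mathcal{G})=\mathrm{diag}((N_1+1)^{-1},\ldots,(N_n+1)^{-1})$. $\mathrm{I}_n$ is the identity matrix and $\mathbf{1}_n$ the all-ones column vector in $\mathbb{R}^n$. For a linear system $\dot e=\tilde A_0e$, Lyapunov stability means Lyapunov stability of the system matrix: every eigenvalue of $\tilde A_0$ has nonpositive real part and every eigenvalue with zero real part is semisimple (equivalently, the zero solution is Lyapunov stable). Origin of the system: $e=[\tilde x^{\mathrm T},\tilde w^{\mathrm T}]^{\mathrm T}$ with $\tilde x=x-\hat x$, $\tilde w=\hat w-w$, where $\dot x=-\mathcal{L}(\mathcal{G})x-\hat w+w$ ($w\in\mathbb{R}^n$ an unknown constant disturbance), $\dot{\hat w}=K\mathcal{Q}(\mathcal{G})(x-\hat x)$ and $\dot{\hat x}=-\mathcal{L}(\mathcal{G})\hat x+M(x-\hat x)$. *)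

theory Defs
  imports "HOL-Analysis.Analysis"
begin

text \<open>
  The nodes of the graph are the elements of a finite type \<open>'n\<close>, so \<open>n = CARD('n)\<close>.  A graph
  is given by its adjacency relation \<open>E\<close>; it is undirected and without self-loops if \<open>E\<close> is
  symmetric and irreflexive, and connected if any two nodes are joined by a path.
\<close>

definition connected_undirected_graph :: "('n \<Rightarrow> 'n \<Rightarrow> bool) \<Rightarrow> bool" where
  "connected_undirected_graph E \<longleftrightarrow> symp E \<and> irreflp E \<and> (\<forall>i j. E\<^sup>*\<^sup>* i j)"

definition diag :: "('n \<Rightarrow> 'a::zero) \<Rightarrow> 'a^'n^'n" where
  "diag d = (\<chi> i j. if i = j then d i else 0)"

definition num_neighbors :: "('n::finite \<Rightarrow> 'n \<Rightarrow> bool) \<Rightarrow> 'n \<Rightarrow> nat" where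
  "num_neighbors E i = card {j. E i j}"

definition adjacency :: "('n::finite \<Rightarrow> 'n \<Rightarrow> bool) \<Rightarrow> real^'n^'n" where
  "adjacency E = (\<chi> i j. if E i j then 1 else 0)"

definition degree_matrix :: "('n::finite \<Rightarrow> 'n \<Rightarrow> bool) \<Rightarrow> real^'n^'n" where
  "degree_matrix E = diag (\<lambda>i. real (num_neighbors E i))"

definition laplacian :: "('n::finite \<Rightarrow> 'n \<Rightarrow> bool) \<Rightarrow> real^'n^'n" where
  "laplacian E = degree_matrix E - adjacency E"

definition scaling_matrix :: "('n::finite \<Rightarrow> 'n \<Rightarrow> bool) \<Rightarrow> real^'n^'n" where
  "scaling_matrix E = diag (\<lambda>i. inverse (real (num_neighbors E i) + 1))"

definition Q_matrix :: "('n::finite \<Rightarrow> 'n \<Rightarrow> bool) \<Rightarrow> real^'n^'n" where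
  "Q_matrix E = mat 1 - scaling_matrix E ** (mat 1 + adjacency E)"

text \<open>
  Block vectors and block matrices are indexed by the disjoint sum of the index types, so that
  \<open>real^('n + 'n)\<close> plays the role of the \<open>2n\<close>-dimensional Euclidean space.
\<close>

definition block_vector :: "'a^'m::finite \<Rightarrow> 'a^'n::finite \<Rightarrow> 'a^('m + 'n)" where
  "block_vector x y = (\<chi> i. case i of Inl a \<Rightarrow> x $ a | Inr b \<Rightarrow> y $ b)"

definition block_matrix ::
  "'a^'p::finite^'m::finite \<Rightarrow> 'a^'q::finite^'m \<Rightarrow> 'a^'p^'n::finite \<Rightarrow> 'a^'q^'n
    \<Rightarrow> 'a^('p + 'q)^('m + 'n)" where
  "block_matrix A B C D =
    (\<chi> i. case i of Inl a \<Rightarrow> block_vector (A $ a) (B $ a)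
                 | Inr b \<Rightarrow> block_vector (C $ b) (D $ b))"

definition error_matrix ::
  "('n::finite \<Rightarrow> 'n \<Rightarrow> bool) \<Rightarrow> ('n \<Rightarrow> real) \<Rightarrow> real \<Rightarrow> real^('n + 'n)^('n + 'n)" where
  "error_matrix E k m =
    (let K = diag k;
         M = m *\<^sub>R mat 1;
         A = - laplacian E - M
     in block_matrix A (- mat 1) (K ** Q_matrix E) 0)"

definition linear_ode_solution ::
  "real^'n^'n \<Rightarrow> real^'n::finite \<Rightarrow> (real \<Rightarrow> real^'n) \<Rightarrow> bool" where
  "linear_ode_solution A e0 e \<longleftrightarrow>
    e 0 = e0 \<and> (\<forall>t\<ge>0. (e has_vector_derivative A *v e t) (at t within {0..}))"

definition eigenspace :: "'a::field^'n^'n \<Rightarrow> 'a \<Rightarrow> ('a^'n::finite) set" where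
  "eigenspace A c = {v. A *v v = c *s v}"

definition is_eigenvalue :: "'a::field^'n^'n::finite \<Rightarrow> 'a \<Rightarrow> bool" where
  "is_eigenvalue A c \<longleftrightarrow> (\<exists>v. v \<noteq> 0 \<and> A *v v = c *s v)"

definition charpoly :: "'a::field^'n^'n::finite \<Rightarrow> 'a poly" where
  "charpoly A = det (\<chi> i j. (if i = j then [:0, 1:] else 0) - [:A $ i $ j:])"

text \<open>Semisimple: the algebraic multiplicity equals the geometric multiplicity.\<close>

definition semisimple_eigenvalue :: "'a::field^'n^'n::finite \<Rightarrow> 'a \<Rightarrow> bool" where
  "semisimple_eigenvalue A c \<longleftrightarrow>
    is_eigenvalue A c \<and> order c (charpoly A) = vec.dim (eigenspace A c)"

text \<open>
  Lyapunov stability of the linear system \<open>e' = A e\<close> is Lyapunov stability of its system matrix;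
  the eigenvalues of the real matrix \<open>A\<close> are taken in the complex numbers.
\<close>

definition lyapunov_stable :: "real^'n^'n::finite \<Rightarrow> bool" where
  "lyapunov_stable A \<longleftrightarrow>
    (let A' = map_matrix complex_of_real A in
      \<forall>c. is_eigenvalue A' c \<longrightarrow>
        Re c \<le> 0 \<and> (Re c = 0 \<longrightarrow> semisimple_eigenvalue A' c))"

end

theory Submission
  imports Defs
begin

text \<open>
  Write \<open>e = (x, w)\<close>, \<open>L\<close> for the Laplacian and \<open>P = K S\<close>.  Since \<open>I - S (I + A) = S L\<close>, where
  \<open>A\<close> denotes the adjacency matrix, the error system reads \<open>x' = - L x - m x - w\<close>, \<open>w' = P L x\<close>.
  It has the equilibrium \<open>r = (1, - m 1)\<close>, and because \<open>L\<close> is symmetric with \<open>L 1 = 0\<close>, the weighted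
  sum \<open>1 \<bullet> P\<^sup>-\<^sup>1 w\<close> is conserved.  It does not vanish at \<open>r\<close>, so the state space splits into the
  line through \<open>r\<close> and the invariant hyperplane on which the conserved sum is zero.

  On this hyperplane the system is exponentially stable.  The natural energy
  \<open>V = x \<bullet> L x + w \<bullet> P\<^sup>-\<^sup>1 w\<close> has the derivative \<open>- 2 (|L x|\<^sup>2 + m x \<bullet> L x)\<close>, which controls only the
  disagreement in \<open>x\<close>.  Adding a correction with the form \<open>m |x|\<^sup>2 + 2 w \<bullet> x\<close> to a large multiple
  \<open>\<alpha> V\<close> repairs this: the correction contributes \<open>- 2 |m x + w|\<^sup>2\<close> and terms that contain \<open>L x\<close>.
  Where the derivative of \<open>V\<close> vanishes, \<open>x\<close> is constant by connectedness, and the hyperplane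
  condition makes \<open>|m x + w|\<^sup>2\<close> positive.  By Finsler's lemma (\<open>finsler\<close>) every sufficiently
  large \<open>\<alpha>\<close> then gives a strict quadratic Lyapunov function on the hyperplane
  (\<open>certificate\<close>).

  The rest holds for any linear system with such data (\<open>semistability_certificate\<close>).  Subtracting
  from a solution its component along \<open>r\<close> leaves a solution in the hyperplane, which decays
  exponentially (\<open>solution_tendsto\<close>).  For the eigenvalues, evaluating the Lyapunov function on real
  and imaginary parts of an eigenvector shows that every nonzero eigenvalue has negative real part
  (\<open>rotating_pair_decays\<close>).  The eigenvalue \<open>0\<close> has the eigenspace spanned by \<open>r\<close> and a left
  eigenvector not orthogonal to \<open>r\<close>, hence it is algebraically simple
  (\<open>semisimple_if_left_right_eigenvectors\<close>).
\<close>

section \<open>Simple eigenvalues\<close>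

lemma poly_det:
  fixes M :: "'a::comm_ring_1 poly^'n^'n::finite"
  shows "poly (det M) z = det (\<chi> i j. poly (M $ i $ j) z)"
  unfolding det_def by (simp add: poly_sum poly_prod)

lemma poly_charpoly:
  fixes A :: "'a::field^'n^'n::finite"
  shows "poly (charpoly A) z = det (mat z - A)"
  unfolding charpoly_def poly_det
  by (rule arg_cong[where f = det]) (simp add: vec_eq_iff mat_def)

lemma mat_mult_vector:
  fixes x :: "'a::field^'n::finite"
  shows "mat z *v x = z *s x"
  by (simp add: vec_eq_iff matrix_vector_mult_def mat_def if_distrib[where f = "\<lambda>a. a * _"] cong: if_cong)

text \<open>
  A nonzero pairing of the left eigenvector \<open>u\<close> with \<open>v\<close> says that \<open>v\<close> is not in the image of
  \<open>A - c\<close>, which excludes a Jordan chain above \<open>v\<close>.  To read the multiplicity off the characteristic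
  polynomial directly, choose \<open>k\<close> with \<open>v $ k \<noteq> 0\<close> and replace column \<open>k\<close> of \<open>X - A\<close>
  by \<open>(X - A) v = (X - c) v\<close>.  This multiplies the determinant by \<open>v $ k\<close>, and it makes a factor
  \<open>X - c\<close> visible.  The cofactor is the determinant of \<open>X - A\<close> with column \<open>k\<close> replaced by \<open>v\<close>, and
  the hypotheses make that matrix injective at \<open>X = c\<close>.
\<close>

lemma semisimple_if_left_right_eigenvectors:
  fixes A :: "'a::field_char_0^'n^'n::finite" and u v :: "'a^'n"
  assumes right: "A *v v = c *s v"
    and left: "\<And>y. (\<Sum>i\<in>UNIV. u $ i * (A *v y) $ i) = c * (\<Sum>i\<in>UNIV. u $ i * y $ i)"
    and transversal: "(\<Sum>i\<in>UNIV. u $ i * v $ i) \<noteq> 0"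
    and line: "\<And>y. A *v y = c *s y \<Longrightarrow> \<exists>a. y = a *s v"
  shows "semisimple_eigenvalue A c"
proof -
  have "v \<noteq> 0"
    using transversal by auto
  then obtain k where k: "v $ k \<noteq> 0"
    by (auto simp: vec_eq_iff)
  define M where "M = (\<chi> i j. if j = k then [:v $ i:] else (if i = j then [:0, 1:] else 0) - [:A $ i $ j:])"
  define N where "N z = (\<chi> i j. if j = k then v $ i else (mat z - A) $ i $ j)" for z
  have poly_M: "poly (det M) z = det (N z)" for z
    unfolding poly_det
    by (rule arg_cong[where f = det]) (simp add: M_def N_def vec_eq_iff mat_def)
  have factor: "v $ k * poly (charpoly A) z = (z - c) * poly (det M) z" for z
  proof -
    have eig: "(mat z - A) *v v = (z - c) *s v"
      using right
      by (simp add: matrix_vector_mult_diff_rdistrib mat_mult_vector vec.scale_left_diff_distrib)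
    have "v $ k * poly (charpoly A) z
        = det (\<chi> i j. if j = k then ((mat z - A) *v v) $ i else (mat z - A) $ i $ j)"
      by (simp only: poly_charpoly cramer_lemma)
    also have "\<dots> = det (\<chi> i j. if j = k then (N z *v ((z - c) *s axis k 1)) $ i else N z $ i $ j)"
    proof -
      have "N z *v (d *s axis k 1) = d *s v" for d
        by (simp add: vec_eq_iff N_def matrix_vector_mult_def axis_def
            if_distrib[where f = "\<lambda>a. _ * a"] cong: if_cong)
      from this[of "z - c"] show ?thesis
        unfolding eig by (intro arg_cong[where f = det]) (simp only: vec_eq_iff vec_lambda_beta, simp add: N_def)
    qed
    also have "\<dots> = (z - c) * poly (det M) z"
      by (simp add: cramer_lemma poly_M)
    finally show ?thesis .
  qed
  \<comment> \<open>Pairing with \<open>u\<close> kills the image of \<open>c - A\<close> and isolates the coefficient of \<open>v\<close>.\<close>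
  have inj: "y = 0" if "N c *v y = 0" for y
  proof -
    define y' where "y' = (\<chi> i. if i = k then 0 else y $ i)"
    have "N c *v y = y $ k *s v + (mat c - A) *v y'"
      unfolding vec_eq_iff matrix_vector_mult_def y'_def N_def
      by (auto simp: sum.remove[of UNIV k] intro!: sum.cong)
    with that have *: "A *v y' = c *s y' + y $ k *s v"
      by (simp add: matrix_vector_mult_diff_rdistrib mat_mult_vector algebra_simps)
    have "(\<Sum>i\<in>UNIV. u $ i * (c *s y' + y $ k *s v) $ i)
        = c * (\<Sum>i\<in>UNIV. u $ i * y' $ i) + y $ k * (\<Sum>i\<in>UNIV. u $ i * v $ i)"
      by (simp add: algebra_simps sum.distrib sum_distrib_left)
    with left[of y'] * transversal have yk: "y $ k = 0"
      by simp
    with * obtain a where a: "y' = a *s v"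
      using line by auto
    have "y' $ k = 0"
      by (simp add: y'_def)
    with a k have "a = 0"
      by simp
    with a have "y' = 0"
      by simp
    moreover have "y' = y"
      using yk by (auto simp: y'_def vec_eq_iff)
    ultimately show "y = 0"
      by simp
  qed
  then have "det (N c) \<noteq> 0"
    by (metis invertible_det_nz invertible_left_inverse matrix_left_invertible_ker)
  then have det_M: "poly (det M) c \<noteq> 0"
    by (simp add: poly_M)
  have "poly (smult (v $ k) (charpoly A)) = poly ([:- c, 1:] * det M)"
    by (rule ext) (use factor in \<open>simp add: algebra_simps\<close>)
  then have "smult (v $ k) (charpoly A) = [:- c, 1:] * det M"
    by (simp only: poly_eq_poly_eq_iff)
  moreover have "order c (smult (v $ k) (charpoly A)) = order c (charpoly A)"
    using k by (simp add: order_smult)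
  moreover have "order c ([:- c, 1:] * det M) = 1"
  proof -
    have "det M \<noteq> 0"
      using det_M by auto
    then have "[:- c, 1:] * det M \<noteq> 0"
      by (simp only: mult_eq_0_iff pCons_eq_0_iff) simp
    then show ?thesis
      using order_power_n_n[of c 1] order_0I[OF det_M]
      by (metis add.right_neutral order_mult power_one_right)
  qed
  ultimately have order: "order c (charpoly A) = 1"
    by simp
  have "eigenspace A c = vec.span {v}"
    using line right by (auto simp: eigenspace_def vec.span_singleton vec.scale mult.commute)
  then have "vec.dim (eigenspace A c) = 1"
    using \<open>v \<noteq> 0\<close> by simp
  with order right \<open>v \<noteq> 0\<close> show ?thesis
    by (auto simp: semisimple_eigenvalue_def is_eigenvalue_def)
qed

section \<open>Quadratic forms on a subspace\<close>

text \<open>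
  Finsler's lemma.  On the compact part of the unit sphere of \<open>S\<close> where \<open>g \<le> 0\<close> the form \<open>f\<close> is
  bounded away from \<open>0\<close>, so a large multiple of it outweighs \<open>g\<close> there; elsewhere \<open>f\<close> only helps.
  It is stated as an eventuality in \<open>\<alpha>\<close> so that one \<open>\<alpha>\<close> can serve several forms.
\<close>

lemma finsler:
  fixes f g :: "'a::euclidean_space \<Rightarrow> real"
  assumes S: "subspace S"
    and cont: "continuous_on UNIV f" "continuous_on UNIV g"
    and hom: "\<And>c y. f (c *\<^sub>R y) = c\<^sup>2 * f y" "\<And>c y. g (c *\<^sub>R y) = c\<^sup>2 * g y"
    and nonneg: "\<And>y. y \<in> S \<Longrightarrow> 0 \<le> f y"
    and pos: "\<And>y. y \<in> S \<Longrightarrow> y \<noteq> 0 \<Longrightarrow> f y = 0 \<Longrightarrow> 0 < g y"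
  shows "\<forall>\<^sub>F \<alpha> in at_top. \<forall>y\<in>S. y \<noteq> 0 \<longrightarrow> 0 < \<alpha> * f y + g y"
proof -
  define K where "K = S \<inter> sphere 0 1"
  define K0 where "K0 = K \<inter> {y. g y \<le> 0}"
  have K: "compact K"
    unfolding K_def using closed_subspace[OF S] by (intro closed_Int_compact) auto
  have "closed {y. g y \<le> 0}"
    using cont(2) by (intro closed_Collect_le) auto
  then have K0: "compact K0"
    unfolding K0_def using K by blast
  have "bounded (g ` K)"
    using K cont(2) by (intro compact_imp_bounded compact_continuous_image) (auto intro: continuous_on_subset)
  then obtain B where B: "\<And>y. y \<in> K \<Longrightarrow> \<bar>g y\<bar> \<le> B" and "0 < B"
    by (auto simp: bounded_pos)
  obtain c where "0 < c" and c: "\<And>y. y \<in> K0 \<Longrightarrow> c \<le> f y"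
  proof (cases "K0 = {}")
    case True
    then show ?thesis using that[of 1] by auto
  next
    case False
    then obtain y0 where y0: "y0 \<in> K0" "\<And>y. y \<in> K0 \<Longrightarrow> f y0 \<le> f y"
      using continuous_attains_inf[OF K0 False, of f] cont(1) by (auto intro: continuous_on_subset)
    then have "y0 \<in> S" "y0 \<noteq> 0" "g y0 \<le> 0"
      by (auto simp: K0_def K_def)
    with nonneg[of y0] pos[of y0] have "0 < f y0"
      by force
    with y0 that show ?thesis by blast
  qed
  have "0 < \<alpha> * f y + g y" if \<alpha>: "B / c < \<alpha>" and y: "y \<in> S" "y \<noteq> 0" for \<alpha> y
  proof -
    have "0 < \<alpha>"
      using \<alpha> \<open>0 < B\<close> \<open>0 < c\<close> by (meson divide_pos_pos less_trans)
    define z where "z = (1 / norm y) *\<^sub>R y"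
    have zK: "z \<in> K"
      using y S by (auto simp: z_def K_def subspace_scale)
    have "0 < \<alpha> * f z + g z"
    proof (cases "g z \<le> 0")
      case True
      then have "c \<le> f z"
        using c zK by (auto simp: K0_def)
      then have "\<alpha> * c \<le> \<alpha> * f z"
        using \<open>0 < \<alpha>\<close> by simp
      moreover have "B < \<alpha> * c"
        using \<alpha> \<open>0 < c\<close> by (simp add: field_simps)
      ultimately show ?thesis
        using B[OF zK] by linarith
    next
      case False
      have "0 \<le> f z"
        using zK nonneg by (auto simp: K_def)
      with False \<open>0 < \<alpha>\<close> show ?thesis
        by (simp add: add_nonneg_pos)
    qed
    also have "\<alpha> * f z + g z = (1 / norm y)\<^sup>2 * (\<alpha> * f y + g y)"
      unfolding z_def hom by (simp add: algebra_simps)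
    finally show ?thesis
      using y by (simp add: zero_less_mult_iff)
  qed
  then show ?thesis
    by (intro eventually_mono[OF eventually_gt_at_top[of "B / c"]]) blast
qed

text \<open>
  The case of Finsler's lemma in which \<open>f\<close> vanishes only at \<open>0\<close>.  It supplies all constants of the
  decay estimate below.
\<close>

lemma positive_form_dominates:
  fixes f g :: "'a::euclidean_space \<Rightarrow> real"
  assumes S: "subspace S"
    and cont: "continuous_on UNIV f" "continuous_on UNIV g"
    and hom: "\<And>c y. f (c *\<^sub>R y) = c\<^sup>2 * f y" "\<And>c y. g (c *\<^sub>R y) = c\<^sup>2 * g y"
    and pos: "\<And>y. y \<in> S \<Longrightarrow> y \<noteq> 0 \<Longrightarrow> 0 < f y"
  obtains c where "0 < c" "\<And>y. y \<in> S \<Longrightarrow> c * g y \<le> f y"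
proof -
  have zero: "f 0 = 0" "g 0 = 0"
    using hom(1)[of 0 0] hom(2)[of 0 0] by auto
  have "\<forall>\<^sub>F \<alpha> in at_top. \<forall>y\<in>S. y \<noteq> 0 \<longrightarrow> 0 < \<alpha> * f y + - g y"
  proof (rule finsler[OF S])
    show "0 \<le> f y" if "y \<in> S" for y
      using pos[OF that] zero by (cases "y = 0") auto
    show "0 < - g y" if "y \<in> S" "y \<noteq> 0" "f y = 0" for y
      using pos[of y] that by simp
  qed (use cont hom in \<open>auto intro: continuous_on_minus\<close>)
  from eventually_happens'[OF _ eventually_conj[OF this eventually_gt_at_top[of 0]]]
  obtain \<alpha> where \<alpha>: "0 < \<alpha>" "\<And>y. y \<in> S \<Longrightarrow> y \<noteq> 0 \<Longrightarrow> g y < \<alpha> * f y"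
    by auto
  show ?thesis
  proof
    show "0 < 1 / \<alpha>" using \<alpha> by simp
    show "1 / \<alpha> * g y \<le> f y" if "y \<in> S" for y
      using \<alpha>(2)[OF that] \<alpha>(1) zero by (cases "y = 0") (auto simp: field_simps)
  qed
qed

lemma bilinear_form_composition:
  fixes b :: "real^'n::finite \<Rightarrow> real^'n \<Rightarrow> real" and B :: "real^'n^'n"
  assumes "bilinear b"
  shows "continuous_on UNIV (\<lambda>y. b y (B *v y))"
    and "b (c *\<^sub>R y) (B *v (c *\<^sub>R y)) = c\<^sup>2 * b y (B *v y)"
proof -
  show "continuous_on UNIV (\<lambda>y. b y (B *v y))"
    using assms unfolding bilinear_conv_bounded_bilinear
    by (rule bounded_bilinear.continuous_on) (intro continuous_intros)+
  show "b (c *\<^sub>R y) (B *v (c *\<^sub>R y)) = c\<^sup>2 * b y (B *v y)"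
    by (simp add: matrix_vector_mult_scaleR bilinear_lmul[OF assms] bilinear_rmul[OF assms]
        power2_eq_square)
qed

section \<open>Certificates for convergence to a line of equilibria\<close>

text \<open>
  The hyperplane \<open>u \<bullet> y = 0\<close> is invariant under \<open>y' = A y\<close> and, since \<open>u \<bullet> r \<noteq> 0\<close>,
  complementary to the line of equilibria through \<open>r\<close>.  On it the form \<open>h\<close> is a strict Lyapunov function; its derivative along \<open>y' = A y\<close> is \<open>2 * h y (A y)\<close>.
\<close>

locale semistability_certificate =
  fixes A :: "real^'n^'n::finite" and u r :: "real^'n" and h :: "real^'n \<Rightarrow> real^'n \<Rightarrow> real"
  assumes equilibrium: "A *v r = 0"
    and conserved: "\<And>y. u \<bullet> (A *v y) = 0"
    and transversal: "u \<bullet> r \<noteq> 0"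
    and h_bilinear: "bilinear h"
    and h_sym: "\<And>x y. h x y = h y x"
    and h_pos: "\<And>y. u \<bullet> y = 0 \<Longrightarrow> y \<noteq> 0 \<Longrightarrow> 0 < h y y"
    and h_decrease: "\<And>y. u \<bullet> y = 0 \<Longrightarrow> y \<noteq> 0 \<Longrightarrow> h y (A *v y) < 0"
begin

lemma h_bounded_bilinear: "bounded_bilinear h"
  using h_bilinear by (simp add: bilinear_conv_bounded_bilinear)

lemma continuous_on_h [continuous_intros]:
  "continuous_on T f \<Longrightarrow> continuous_on T g \<Longrightarrow> continuous_on T (\<lambda>x. h (f x) (g x))"
  by (rule bounded_bilinear.continuous_on[OF h_bounded_bilinear])

lemma h_scale: "h (c *\<^sub>R x) y = c * h x y" "h x (c *\<^sub>R y) = c * h x y"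
  using h_bilinear by (auto simp: bilinear_lmul bilinear_rmul)

lemma h_diff: "h x (y - z) = h x y - h x z"
  using h_bilinear by (rule bilinear_rsub)

lemma h_add: "h x (y + z) = h x y + h x z"
  using h_bilinear by (rule bilinear_radd)

lemma subspace_complement: "subspace {y. u \<bullet> y = 0}"
  by (rule subspace_hyperplane)

lemma rates:
  obtains c \<gamma> where "0 < c" "0 < \<gamma>"
    and "\<And>y. u \<bullet> y = 0 \<Longrightarrow> c * (norm y)\<^sup>2 \<le> h y y"
    and "\<And>y. u \<bullet> y = 0 \<Longrightarrow> \<gamma> * h y y \<le> - h y (A *v y)"
proof -
  obtain c where "0 < c" "\<And>y. y \<in> {y. u \<bullet> y = 0} \<Longrightarrow> c * (norm y)\<^sup>2 \<le> h y y"
    by (rule positive_form_dominates[OF subspace_complement, of "\<lambda>y. h y y" "\<lambda>y. (norm y)\<^sup>2"])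
       (auto intro!: continuous_intros h_pos simp: h_scale power2_eq_square)
  moreover obtain \<gamma> where "0 < \<gamma>" "\<And>y. y \<in> {y. u \<bullet> y = 0} \<Longrightarrow> \<gamma> * h y y \<le> - h y (A *v y)"
    by (rule positive_form_dominates[OF subspace_complement, of "\<lambda>y. - h y (A *v y)" "\<lambda>y. h y y"])
       (auto intro!: continuous_intros h_decrease simp: h_scale power2_eq_square matrix_vector_mult_scaleR)
  ultimately show ?thesis
    using that by simp
qed

lemma solution_in_complement_tends_to_0:
  assumes deriv: "\<And>t. 0 \<le> t \<Longrightarrow> (y has_vector_derivative A *v y t) (at t within {0..})"
    and inv: "\<And>t. 0 \<le> t \<Longrightarrow> u \<bullet> y t = 0"
  shows "(y \<longlongrightarrow> 0) at_top"
proof -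
  obtain c \<gamma> where c: "0 < c" "0 < \<gamma>" "\<And>y. u \<bullet> y = 0 \<Longrightarrow> c * (norm y)\<^sup>2 \<le> h y y"
      "\<And>y. u \<bullet> y = 0 \<Longrightarrow> \<gamma> * h y y \<le> - h y (A *v y)"
    using rates by blast
  \<comment> \<open>The exponential weight turns the decay estimate for \<open>h y y\<close> into monotonicity of \<open>W\<close>.\<close>
  define W where "W t = exp (2 * \<gamma> * t) * h (y t) (y t)" for t
  have W_deriv: "(W has_real_derivative
      exp (2 * \<gamma> * t) * (2 * \<gamma> * h (y t) (y t) + 2 * h (y t) (A *v y t))) (at t within {0..})"
    if "0 \<le> t" for t
  proof -
    have "((\<lambda>t. h (y t) (y t)) has_real_derivative 2 * h (y t) (A *v y t)) (at t within {0..})"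
      using bounded_bilinear.has_vector_derivative[OF h_bounded_bilinear deriv[OF that] deriv[OF that]]
      by (simp add: has_real_derivative_iff_has_vector_derivative h_sym[of "A *v y t" "y t"])
    then show ?thesis
      unfolding W_def by (auto intro!: derivative_eq_intros simp: algebra_simps)
  qed
  have W_decr: "W t \<le> W 0" if "0 \<le> t" for t
  proof (rule DERIV_nonpos_imp_decreasing_open[OF that])
    fix s assume s: "0 < s" "s < t"
    then have "(at s within {0..}) = at s"
      by (intro at_within_interior) simp
    with W_deriv[of s] s have "DERIV W s :> exp (2 * \<gamma> * s) * (2 * \<gamma> * h (y s) (y s) + 2 * h (y s) (A *v y s))"
      by simp
    moreover have "exp (2 * \<gamma> * s) * (2 * \<gamma> * h (y s) (y s) + 2 * h (y s) (A *v y s)) \<le> 0"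
      using c(4)[OF inv, of s] s by (intro mult_nonneg_nonpos) auto
    ultimately show "\<exists>z. DERIV W s :> z \<and> z \<le> 0"
      by blast
  next
    have "continuous_on {0..} W"
      by (rule DERIV_continuous_on, rule W_deriv) simp
    then show "continuous_on {0..t} W"
      by (rule continuous_on_subset) auto
  qed
  have "(norm (y t))\<^sup>2 \<le> W 0 / c * exp (- (2 * \<gamma>) * t)" if "0 \<le> t" for t
  proof -
    have "c * (norm (y t))\<^sup>2 * exp (2 * \<gamma> * t) \<le> W t"
      unfolding W_def using c(3)[OF inv[OF that]] by simp
    also have "\<dots> \<le> W 0"
      by (rule W_decr[OF that])
    finally show ?thesis
      using c(1) by (simp add: exp_minus field_simps)
  qed
  then have bound: "\<forall>\<^sub>F t in at_top. (norm (y t))\<^sup>2 \<le> W 0 / c * exp (- (2 * \<gamma>) * t)"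
    by (intro eventually_mono[OF eventually_ge_at_top[of 0]]) blast
  have lim: "((\<lambda>t. W 0 / c * exp (- (2 * \<gamma>) * t)) \<longlongrightarrow> 0) at_top"
  proof -
    have "filterlim (\<lambda>t. - (2 * \<gamma>) * t) at_bot at_top"
      using c(2) by (intro filterlim_tendsto_neg_mult_at_bot[OF tendsto_const]) (auto simp: filterlim_ident)
    then show ?thesis
      by (intro tendsto_mult_right_zero filterlim_compose[OF exp_at_bot])
  qed
  have "((\<lambda>t. (norm (y t))\<^sup>2) \<longlongrightarrow> 0) at_top"
    by (rule Lim_null_comparison[OF _ lim]) (use bound in simp)
  then have "((\<lambda>t. sqrt ((norm (y t))\<^sup>2)) \<longlongrightarrow> sqrt 0) at_top"
    by (rule tendsto_real_sqrt)
  then show ?thesis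
    by (simp add: tendsto_norm_zero_iff)
qed

text \<open>
  The coefficient of the limit depends only on the conserved quantity \<open>u \<bullet> e0\<close>, so it is the same
  for all solutions with initial value \<open>e0\<close>.
\<close>

theorem solution_tendsto:
  assumes "linear_ode_solution A e0 e"
  shows "(e \<longlongrightarrow> (u \<bullet> e0 / (u \<bullet> r)) *\<^sub>R r) at_top"
proof -
  define \<epsilon> where "\<epsilon> = u \<bullet> e0 / (u \<bullet> r)"
  have e: "e 0 = e0" "\<And>t. 0 \<le> t \<Longrightarrow> (e has_vector_derivative A *v e t) (at t within {0..})"
    using assms by (auto simp: linear_ode_solution_def)
  have "((\<lambda>t. u \<bullet> e t) has_real_derivative 0) (at t within {0..})" if "0 \<le> t" for t
    using bounded_linear.has_vector_derivative[OF bounded_linear_inner_right[of u] e(2)[OF that]]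
    by (simp add: has_real_derivative_iff_has_vector_derivative conserved)
  then obtain d where d: "\<And>t. 0 \<le> t \<Longrightarrow> u \<bullet> e t = d"
    using has_field_derivative_zero_constant[of "{0..}" "\<lambda>t. u \<bullet> e t"] by auto
  have "((\<lambda>t. e t - \<epsilon> *\<^sub>R r) \<longlongrightarrow> 0) at_top"
  proof (rule solution_in_complement_tends_to_0)
    fix t :: real assume t: "0 \<le> t"
    show "((\<lambda>t. e t - \<epsilon> *\<^sub>R r) has_vector_derivative A *v (e t - \<epsilon> *\<^sub>R r)) (at t within {0..})"
      using has_vector_derivative_diff[OF e(2)[OF t] has_vector_derivative_const[of "\<epsilon> *\<^sub>R r"]]
      by (simp add: matrix_vector_mult_diff_distrib matrix_vector_mult_scaleR equilibrium)
    show "u \<bullet> (e t - \<epsilon> *\<^sub>R r) = 0"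
      using d[OF t] d[of 0] e(1) transversal by (simp add: \<epsilon>_def inner_diff_right)
  qed
  then show ?thesis
    unfolding \<epsilon>_def[symmetric] using Lim_null by blast
qed

lemma kernel_line:
  assumes "A *v y = 0"
  shows "y = (u \<bullet> y / (u \<bullet> r)) *\<^sub>R r"
proof (rule ccontr)
  define z where "z = y - (u \<bullet> y / (u \<bullet> r)) *\<^sub>R r"
  assume "\<not> ?thesis"
  then have "z \<noteq> 0"
    by (simp add: z_def)
  moreover have "u \<bullet> z = 0"
    using transversal by (simp add: z_def inner_diff_right)
  moreover have "A *v z = 0"
    using assms by (simp add: z_def matrix_vector_mult_diff_distrib matrix_vector_mult_scaleR equilibrium)
  ultimately show False
    using h_decrease[of z] h_scale(2)[of z 0 0] by simp
qed

text \<open>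
  Here \<open>p\<close> and \<open>q\<close> are the real and imaginary parts of an eigenvector for the nonzero eigenvalue
  \<open>a + \<i> b\<close>.  Both lie in the hyperplane, because \<open>u\<close> is a left eigenvector for the eigenvalue \<open>0\<close>.
  In \<open>h p (A p) + h q (A q)\<close> the terms with \<open>b\<close> cancel by symmetry.
\<close>

lemma rotating_pair_decays:
  assumes p: "A *v p = a *\<^sub>R p - b *\<^sub>R q" and q: "A *v q = b *\<^sub>R p + a *\<^sub>R q"
    and nz: "p \<noteq> 0 \<or> q \<noteq> 0" and ab: "a \<noteq> 0 \<or> b \<noteq> 0"
  shows "a < 0"
proof -
  have "a * (u \<bullet> p) - b * (u \<bullet> q) = 0" "b * (u \<bullet> p) + a * (u \<bullet> q) = 0"
    using conserved[of p] conserved[of q] by (simp_all add: p q inner_diff_right inner_add_right)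
  then have "(a\<^sup>2 + b\<^sup>2) * (u \<bullet> p) = 0" "(a\<^sup>2 + b\<^sup>2) * (u \<bullet> q) = 0"
    by algebra+
  moreover have "a\<^sup>2 + b\<^sup>2 \<noteq> 0"
    using ab by (simp add: sum_power2_eq_zero_iff)
  ultimately have up: "u \<bullet> p = 0" "u \<bullet> q = 0"
    by auto
  have le: "0 \<le> h z z" "h z (A *v z) \<le> 0" if "u \<bullet> z = 0" for z
    using h_pos[of z] h_decrease[of z] that h_scale(2)[of 0 0 0]
    by (cases "z = 0"; simp add: less_imp_le)+
  have pos: "0 < h p p + h q q" and neg: "h p (A *v p) + h q (A *v q) < 0"
    using nz h_pos[OF up(1)] h_pos[OF up(2)] h_decrease[OF up(1)] h_decrease[OF up(2)]
      le[OF up(1)] le[OF up(2)] by linarith+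
  have "h p (A *v p) + h q (A *v q) = a * (h p p + h q q)"
    by (simp add: p q h_diff h_add h_scale h_sym[of q p] algebra_simps)
  with pos neg show "a < 0"
    by (metis mult_less_0_iff not_less_iff_gr_or_eq)
qed

theorem lyapunov_stable: "lyapunov_stable A"
proof -
  define C where "C = map_matrix complex_of_real A"
  define V where "V = (\<chi> i. complex_of_real (r $ i))"
  define U where "U = (\<chi> i. complex_of_real (u $ i))"
  define re where "re v = (\<chi> i. Re (v $ i))" for v :: "complex^'n"
  define im where "im v = (\<chi> i. Im (v $ i))" for v :: "complex^'n"
  have re_C: "re (C *v v) = A *v re v" and im_C: "im (C *v v) = A *v im v" for v
    by (simp_all add: vec_eq_iff re_def im_def C_def matrix_vector_mult_def)
  have eqI: "v = w" if "re v = re w" "im v = im w" for v w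
    using that by (simp add: vec_eq_iff re_def im_def complex_eq_iff)
  have parts: "A *v re v = Re c *\<^sub>R re v - Im c *\<^sub>R im v"
      "A *v im v = Im c *\<^sub>R re v + Re c *\<^sub>R im v" if "C *v v = c *s v" for c v
    unfolding re_C[symmetric] im_C[symmetric] that
    by (simp_all add: vec_eq_iff re_def im_def)
  have only_zero: "c = 0" if "is_eigenvalue C c" "0 \<le> Re c" for c
  proof -
    obtain v where v: "v \<noteq> 0" "C *v v = c *s v"
      using \<open>is_eigenvalue C c\<close> by (auto simp: is_eigenvalue_def)
    have "re v \<noteq> 0 \<or> im v \<noteq> 0"
      using eqI[of v 0] v(1) by (auto simp: re_def im_def vec_eq_iff)
    with rotating_pair_decays[OF parts[OF v(2)]] that(2) show "c = 0"
      by (auto simp: complex_eq_iff)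
  qed
  have "semisimple_eigenvalue C 0"
  proof (rule semisimple_if_left_right_eigenvectors[where u = U and v = V])
    have reV: "re V = r" "im V = 0"
      by (simp_all add: vec_eq_iff re_def im_def V_def)
    show "C *v V = 0 *s V"
      by (rule eqI; unfold re_C im_C reV) (simp_all add: equilibrium re_def im_def vec_eq_iff)
    show "(\<Sum>i\<in>UNIV. U $ i * (C *v y) $ i) = 0 * (\<Sum>i\<in>UNIV. U $ i * y $ i)" for y
    proof -
      have "Re (\<Sum>i\<in>UNIV. U $ i * (C *v y) $ i) = u \<bullet> re (C *v y)"
        and "Im (\<Sum>i\<in>UNIV. U $ i * (C *v y) $ i) = u \<bullet> im (C *v y)"
        by (simp_all add: U_def inner_vec_def re_def im_def)
      then show ?thesis
        by (simp add: re_C im_C conserved complex_eq_iff)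
    qed
    have "(\<Sum>i\<in>UNIV. U $ i * V $ i) = complex_of_real (u \<bullet> r)"
      by (simp add: U_def V_def inner_vec_def)
    then show "(\<Sum>i\<in>UNIV. U $ i * V $ i) \<noteq> 0"
      using transversal by simp
    fix y assume "C *v y = 0 *s y"
    then have *: "A *v re y = 0" "A *v im y = 0"
      using parts[of y 0] by simp_all
    have "y = Complex (u \<bullet> re y / (u \<bullet> r)) (u \<bullet> im y / (u \<bullet> r)) *s V"
      by (rule eqI; subst kernel_line[OF *(1)] kernel_line[OF *(2)])
         (simp_all add: vec_eq_iff re_def im_def V_def)
    then show "\<exists>a. y = a *s V" ..
  qed
  then show ?thesis
    unfolding lyapunov_stable_def Let_def C_def[symmetric]
    using only_zero by (metis linear order_refl zero_complex.sel(1))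
qed

end

section \<open>The graph Laplacian\<close>

lemma diag_mult_vector:
  fixes x :: "real^'n::finite"
  shows "(diag d *v x) $ i = d i * x $ i"
  by (simp add: matrix_vector_mult_def diag_def if_distrib[where f = "\<lambda>a. a * _"] cong: if_cong)

lemma adjacency_mult_vector: "(adjacency E *v x) $ i = (\<Sum>j | E i j. x $ j)"
  by (simp add: matrix_vector_mult_def adjacency_def if_distrib[where f = "\<lambda>a. a * _"]
      sum.If_cases cong: if_cong)

lemma laplacian_mult_vector: "(laplacian E *v x) $ i = (\<Sum>j | E i j. x $ i - x $ j)"
  by (simp add: laplacian_def degree_matrix_def num_neighbors_def matrix_vector_mult_diff_rdistrib
      diag_mult_vector adjacency_mult_vector sum_subtractf)

text \<open>
  Because \<open>S (D + I) = I\<close>, the coupling matrix is a row scaling of the Laplacian, and \<open>K Q\<close> is a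
  positive diagonal matrix times the Laplacian.
\<close>

lemma Q_matrix_eq: "Q_matrix E = scaling_matrix E ** laplacian E"
proof -
  have "Q_matrix E *v x = (scaling_matrix E ** laplacian E) *v x" for x
    by (simp add: vec_eq_iff Q_matrix_def scaling_matrix_def laplacian_def degree_matrix_def
        matrix_vector_mult_diff_rdistrib matrix_vector_mult_add_rdistrib diag_mult_vector
        matrix_vector_mul_assoc[symmetric] field_simps)
  then show ?thesis
    by (simp add: matrix_eq)
qed

text \<open>
  Symmetry, semidefiniteness and the kernel of the Laplacian are all visible in this expression as a
  sum over edges; the factor \<open>1/2\<close> is there because each edge occurs in both directions.
\<close>

lemma laplacian_form:
  fixes x y :: "real^'n::finite"
  assumes "symp E"
  shows "x \<bullet> (laplacian E *v y)
    = (\<Sum>i\<in>UNIV. \<Sum>j\<in>UNIV. if E i j then (x $ i - x $ j) * (y $ i - y $ j) else 0) / 2"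
proof -
  have eq: "x \<bullet> (laplacian E *v y) = (\<Sum>i\<in>UNIV. \<Sum>j\<in>UNIV. if E i j then x $ i * (y $ i - y $ j) else 0)"
    by (simp add: inner_vec_def laplacian_mult_vector sum_distrib_left sum.If_cases)
  also have "\<dots> = (\<Sum>i\<in>UNIV. \<Sum>j\<in>UNIV. if E j i then x $ j * (y $ j - y $ i) else 0)"
    by (rule sum.swap)
  also have "\<dots> = (\<Sum>i\<in>UNIV. \<Sum>j\<in>UNIV. if E i j then - x $ j * (y $ i - y $ j) else 0)"
    using assms by (intro sum.cong refl) (auto simp: symp_def algebra_simps)
  finally have "2 * (x \<bullet> (laplacian E *v y))
      = (\<Sum>i\<in>UNIV. \<Sum>j\<in>UNIV. if E i j then x $ i * (y $ i - y $ j) else 0)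
        + (\<Sum>i\<in>UNIV. \<Sum>j\<in>UNIV. if E i j then - x $ j * (y $ i - y $ j) else 0)"
    using eq by simp
  also have "\<dots> = (\<Sum>i\<in>UNIV. \<Sum>j\<in>UNIV. if E i j then (x $ i - x $ j) * (y $ i - y $ j) else 0)"
    by (auto simp: sum.distrib[symmetric] algebra_simps intro!: sum.cong)
  finally show ?thesis by simp
qed

lemma laplacian_sym: "symp E \<Longrightarrow> x \<bullet> (laplacian E *v y) = y \<bullet> (laplacian E *v x)"
  unfolding laplacian_form
  by (intro arg_cong[where f = "\<lambda>s. s / 2"] sum.cong refl) (auto simp: mult.commute)

lemma laplacian_nonneg: "symp E \<Longrightarrow> 0 \<le> x \<bullet> (laplacian E *v x)"
  by (auto simp: laplacian_form intro!: sum_nonneg)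

lemma laplacian_const: "laplacian E *v (c *\<^sub>R 1) = 0"
  by (simp add: vec_eq_iff laplacian_mult_vector)

lemma laplacian_form_eq_0:
  assumes "connected_undirected_graph E" and "x \<bullet> (laplacian E *v x) = 0"
  obtains c where "x = c *\<^sub>R 1"
proof -
  have sym: "symp E" and conn: "\<And>i j. E\<^sup>*\<^sup>* i j"
    using assms(1) by (auto simp: connected_undirected_graph_def)
  have "(\<Sum>i\<in>UNIV. \<Sum>j\<in>UNIV. if E i j then (x $ i - x $ j) * (x $ i - x $ j) else 0) = 0"
    using assms(2) laplacian_form[OF sym, of x x] by simp
  then have "\<forall>i\<in>UNIV. (\<Sum>j\<in>UNIV. if E i j then (x $ i - x $ j) * (x $ i - x $ j) else 0) = 0"
    by (subst (asm) sum_nonneg_eq_0_iff) (auto intro!: sum_nonneg)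
  then have edge: "x $ i = x $ j" if "E i j" for i j
    using that by (subst (asm) sum_nonneg_eq_0_iff) (auto split: if_splits)
  have path: "x $ i = x $ j" for i j
    using conn[of i j] by (induction rule: rtranclp_induct) (auto dest: edge)
  have "x = (x $ undefined) *\<^sub>R 1"
    using path by (simp add: vec_eq_iff)
  with that show ?thesis .
qed

section \<open>Block vectors\<close>

definition block_fst :: "'a^('m::finite + 'n::finite) \<Rightarrow> 'a^'m" where
  "block_fst y = (\<chi> i. y $ Inl i)"

definition block_snd :: "'a^('m::finite + 'n::finite) \<Rightarrow> 'a^'n" where
  "block_snd y = (\<chi> i. y $ Inr i)"

lemma block_fst_snd_block_vector [simp]:
  "block_fst (block_vector x w) = x" "block_snd (block_vector x w) = w"
  by (simp_all add: block_fst_def block_snd_def block_vector_def vec_eq_iff)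

lemma block_eq_iff: "y = z \<longleftrightarrow> block_fst y = block_fst z \<and> block_snd y = block_snd z"
  unfolding vec_eq_iff block_fst_def block_snd_def by (simp add: split_sum_all)

lemma sum_UNIV_Plus:
  fixes f :: "'m::finite + 'n::finite \<Rightarrow> 'b::comm_monoid_add"
  shows "(\<Sum>i\<in>UNIV. f i) = (\<Sum>i\<in>UNIV. f (Inl i)) + (\<Sum>i\<in>UNIV. f (Inr i))"
  by (simp add: UNIV_Plus_UNIV[symmetric] sum.Plus del: UNIV_Plus_UNIV)

lemma inner_block_vector:
  fixes x :: "real^'m::finite" and w :: "real^'n::finite"
  shows "block_vector x w \<bullet> y = x \<bullet> block_fst y + w \<bullet> block_snd y"
  by (simp add: inner_vec_def sum_UNIV_Plus block_vector_def block_fst_def block_snd_def)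

lemma block_matrix_mult_vector:
  fixes A :: "real^'p::finite^'m::finite" and D :: "real^'q::finite^'n::finite"
  shows "block_fst (block_matrix A B C D *v y) = A *v block_fst y + B *v block_snd y"
    and "block_snd (block_matrix A B C D *v y) = C *v block_fst y + D *v block_snd y"
  by (simp_all add: vec_eq_iff matrix_vector_mult_def sum_UNIV_Plus block_matrix_def
      block_vector_def block_fst_def block_snd_def)

lemma linear_block_fst: "linear (block_fst :: real^('m::finite + 'n::finite) \<Rightarrow> real^'m)"
  by (rule linearI) (simp_all add: block_fst_def vec_eq_iff)

lemma linear_block_snd: "linear (block_snd :: real^('m::finite + 'n::finite) \<Rightarrow> real^'n)"
  by (rule linearI) (simp_all add: block_snd_def vec_eq_iff)

section \<open>The error system\<close>

lemma error_matrix_mult_vector: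
  shows "block_fst (error_matrix E k m *v y)
      = - (laplacian E *v block_fst y) - m *\<^sub>R block_fst y - block_snd y" (is ?fst)
    and "block_snd (error_matrix E k m *v y)
      = diag (\<lambda>i. k i / (real (num_neighbors E i) + 1)) *v (laplacian E *v block_fst y)" (is ?snd)
proof -
  have minus: "- M *v x = - (M *v x)" for M :: "real^'n^'n" and x
    using scaleR_matrix_vector_assoc[of "- 1" M x] by simp
  show ?fst
    by (simp add: error_matrix_def Let_def block_matrix_mult_vector matrix_vector_mult_diff_rdistrib
        scaleR_matrix_vector_assoc[symmetric] minus)
  show ?snd
    by (simp add: error_matrix_def Let_def block_matrix_mult_vector Q_matrix_eq scaling_matrix_def
        matrix_vector_mul_assoc[symmetric] vec_eq_iff diag_mult_vector divide_inverse)
qed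

locale error_system =
  fixes E :: "'n::finite \<Rightarrow> 'n \<Rightarrow> bool" and k :: "'n \<Rightarrow> real" and m :: real
  assumes graph: "connected_undirected_graph E"
    and k_pos: "\<And>i. 0 < k i"
    and m_pos: "0 < m"
begin

text \<open>The diagonal entries of \<open>K S\<close>, so that \<open>K Q = P L\<close> for the diagonal matrix \<open>P\<close> below.\<close>

definition gain :: "'n \<Rightarrow> real" where
  "gain i = k i / (real (num_neighbors E i) + 1)"

abbreviation A where "A \<equiv> error_matrix E k m"
abbreviation L where "L \<equiv> laplacian E"
abbreviation P where "P \<equiv> diag gain"
abbreviation P' where "P' \<equiv> diag (\<lambda>i. inverse (gain i))"

definition consensus :: "real^('n + 'n)" where
  "consensus = block_vector 1 (- m *\<^sub>R 1)"

text \<open>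
  A left null vector of \<open>A\<close>: along solutions the second block \<open>w\<close> has the derivative \<open>P L x\<close>, so
  that of \<open>P' w\<close> is \<open>L x\<close>, and the entries of \<open>L x\<close> sum to \<open>0\<close>.
\<close>

definition invariant :: "real^('n + 'n)" where
  "invariant = block_vector 0 (P' *v 1)"

text \<open>
  The weight \<open>P'\<close> makes the terms with \<open>w \<bullet> L x\<close> cancel in the rate of \<open>storage\<close>.  What remains is
  nonpositive, but it sees only the disagreement in \<open>x\<close>.
\<close>

definition storage :: "real^('n + 'n) \<Rightarrow> real^('n + 'n) \<Rightarrow> real" where
  "storage y z = block_fst y \<bullet> (L *v block_fst z) + block_snd y \<bullet> (P' *v block_snd z)"

text \<open>
  The weights are chosen such that the terms of the rate that survive for \<open>L x = 0\<close> form the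
  negative square norm of \<open>m x + w\<close>, which for such \<open>x\<close> is minus the first block of \<open>A y\<close>.
\<close>

definition cross_form :: "real^('n + 'n) \<Rightarrow> real^('n + 'n) \<Rightarrow> real" where
  "cross_form y z = m * (block_fst y \<bullet> block_fst z)
      + block_snd y \<bullet> block_fst z + block_fst y \<bullet> block_snd z"

lemma symmetric: "symp E"
  using graph by (simp add: connected_undirected_graph_def)

lemma gain_pos: "0 < gain i"
  using k_pos[of i] by (simp add: gain_def add_nonneg_pos)

lemma gain_nonzero [simp]: "gain i \<noteq> 0"
  using gain_pos[of i] by simp

lemma A_mult_vector:
  "block_fst (A *v y) = - (L *v block_fst y) - m *\<^sub>R block_fst y - block_snd y"
  "block_snd (A *v y) = P *v (L *v block_fst y)"
  unfolding gain_def[abs_def] by (simp_all only: error_matrix_mult_vector)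

lemma laplacian_one: "L *v 1 = 0"
  using laplacian_const[of E 1] by simp

lemma gain_inverse: "w \<bullet> (P' *v (P *v z)) = w \<bullet> z" "(P' *v w) \<bullet> (P *v z) = w \<bullet> z"
  by (simp_all add: inner_vec_def diag_mult_vector mult.assoc[symmetric])
     (simp_all add: field_simps)

lemma gain_inverse_sym: "w \<bullet> (P' *v z) = z \<bullet> (P' *v w)"
  by (simp add: inner_vec_def diag_mult_vector algebra_simps)

lemma gain_inverse_form: "w \<bullet> (P' *v w) = (\<Sum>i\<in>UNIV. inverse (gain i) * (w $ i)\<^sup>2)"
  by (simp add: inner_vec_def diag_mult_vector power2_eq_square mult.left_commute)

lemma gain_inverse_nonneg: "0 \<le> w \<bullet> (P' *v w)"
  using gain_pos by (auto simp: gain_inverse_form less_imp_le intro!: sum_nonneg mult_nonneg_nonneg)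

lemma gain_inverse_pos: "w = 0" if "w \<bullet> (P' *v w) = 0"
proof -
  have "\<forall>i\<in>UNIV. inverse (gain i) * (w $ i)\<^sup>2 = 0"
    using that gain_pos unfolding gain_inverse_form
    by (subst (asm) sum_nonneg_eq_0_iff) (auto simp: less_imp_le intro!: mult_nonneg_nonneg)
  then show ?thesis
    by (simp add: vec_eq_iff)
qed

lemma invariant_inner: "invariant \<bullet> y = (P' *v 1) \<bullet> block_snd y"
  by (simp add: invariant_def inner_block_vector)

lemma invariant_consensus: "invariant \<bullet> consensus \<noteq> 0"
  using m_pos gain_inverse_pos[of 1]
  by (auto simp: invariant_inner consensus_def inner_commute)

lemma invariant_conserved: "invariant \<bullet> (A *v y) = 0"
  using laplacian_sym[OF symmetric, of 1 "block_fst y"]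
  by (simp add: invariant_inner A_mult_vector gain_inverse laplacian_one)

lemma consensus_equilibrium: "A *v consensus = 0"
proof -
  have "block_fst (A *v consensus) = 0" "block_snd (A *v consensus) = 0"
    by (simp_all add: A_mult_vector consensus_def laplacian_one)
  then show ?thesis
    unfolding block_eq_iff by (simp add: block_fst_def block_snd_def vec_eq_iff)
qed

lemma storage_rate:
  "storage y (A *v y)
    = - ((L *v block_fst y) \<bullet> (L *v block_fst y) + m * (block_fst y \<bullet> (L *v block_fst y)))"
  using laplacian_sym[OF symmetric, of "block_fst y" "L *v block_fst y"]
    laplacian_sym[OF symmetric, of "block_fst y" "block_snd y"]
  by (simp add: storage_def A_mult_vector gain_inverse matrix_vector_mult_diff_distrib
      matrix_vector_mult_scaleR linear_neg[OF matrix_vector_mul_linear] inner_diff_right)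

lemma cross_form_rate:
  "cross_form y (A *v y)
    = - (m * (block_fst y \<bullet> (L *v block_fst y))) + block_fst y \<bullet> (P *v (L *v block_fst y))
      - block_snd y \<bullet> (L *v block_fst y)
      - (m *\<^sub>R block_fst y + block_snd y) \<bullet> (m *\<^sub>R block_fst y + block_snd y)"
  by (simp add: cross_form_def A_mult_vector inner_diff_right inner_diff_left inner_add_left
      inner_add_right inner_commute[of "block_snd y" "block_fst y"] algebra_simps)

lemma storage_sym: "storage y z = storage z y"
  unfolding storage_def using laplacian_sym[OF symmetric] gain_inverse_sym by metis

lemma cross_form_sym: "cross_form y z = cross_form z y"
  by (simp add: cross_form_def inner_commute algebra_simps)

lemma bilinear_storage: "bilinear storage"
  unfolding bilinear_def storage_def
  by (auto intro!: linearI simp: linear_add[OF linear_block_fst] linear_add[OF linear_block_snd]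
      linear_scale[OF linear_block_fst] linear_scale[OF linear_block_snd]
      matrix_vector_right_distrib matrix_vector_mult_scaleR inner_add_left inner_add_right algebra_simps)

lemma bilinear_cross_form: "bilinear cross_form"
  unfolding bilinear_def cross_form_def
  by (auto intro!: linearI simp: linear_add[OF linear_block_fst] linear_add[OF linear_block_snd]
      linear_scale[OF linear_block_fst] linear_scale[OF linear_block_snd]
      inner_add_left inner_add_right algebra_simps)

text \<open>
  Where \<open>storage\<close> vanishes, \<open>w = 0\<close>, and there \<open>cross_form\<close> is \<open>m\<close> times the square norm of \<open>x\<close>.
\<close>

lemma storage_cross_form_pos:
  "\<forall>\<^sub>F \<alpha> in at_top. \<forall>y. y \<noteq> 0 \<longrightarrow> 0 < \<alpha> * storage y y + cross_form y y"
proof -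
  note storage = bilinear_form_composition[OF bilinear_storage, where B = "mat 1", simplified]
  note cross = bilinear_form_composition[OF bilinear_cross_form, where B = "mat 1", simplified]
  have "\<forall>\<^sub>F \<alpha> in at_top. \<forall>y\<in>UNIV. y \<noteq> 0 \<longrightarrow> 0 < \<alpha> * storage y y + cross_form y y"
  proof (rule finsler[OF subspace_UNIV storage(1) cross(1) storage(2) cross(2)])
    fix y :: "real^('n + 'n)"
    let ?x = "block_fst y" and ?w = "block_snd y"
    have nonneg: "0 \<le> ?x \<bullet> (L *v ?x)" "0 \<le> ?w \<bullet> (P' *v ?w)"
      using laplacian_nonneg[OF symmetric] gain_inverse_nonneg by auto
    then show "0 \<le> storage y y"
      by (simp add: storage_def)
    assume "y \<noteq> 0" "storage y y = 0"
    with nonneg have "?w \<bullet> (P' *v ?w) = 0"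
      by (simp add: storage_def)
    then have w: "?w = 0"
      by (rule gain_inverse_pos)
    with \<open>y \<noteq> 0\<close> have "?x \<noteq> 0"
      by (auto simp: block_eq_iff linear_0[OF linear_block_fst] linear_0[OF linear_block_snd])
    with w m_pos show "0 < cross_form y y"
      by (simp add: cross_form_def)
  qed
  then show ?thesis by simp
qed

text \<open>
  Where the dissipation of \<open>storage\<close> vanishes, \<open>x\<close> is constant, and \<open>cross_form\<close> then dissipates
  the squared norm of \<open>m x + w\<close>.  If this vanishes as well, the state is a multiple of the
  consensus vector, which the conserved quantity rules out.
\<close>

lemma storage_cross_form_decrease:
  "\<forall>\<^sub>F \<alpha> in at_top. \<forall>y. invariant \<bullet> y = 0 \<longrightarrow> y \<noteq> 0 \<longrightarrow>
      \<alpha> * storage y (A *v y) + cross_form y (A *v y) < 0"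
proof -
  note storage = bilinear_form_composition[OF bilinear_storage, where B = A]
  note cross = bilinear_form_composition[OF bilinear_cross_form, where B = A]
  have "\<forall>\<^sub>F \<alpha> in at_top. \<forall>y\<in>{y. invariant \<bullet> y = 0}. y \<noteq> 0 \<longrightarrow>
      0 < \<alpha> * - storage y (A *v y) + - cross_form y (A *v y)"
  proof (rule finsler[OF subspace_hyperplane])
    show "continuous_on UNIV (\<lambda>y. - storage y (A *v y))"
      "continuous_on UNIV (\<lambda>y. - cross_form y (A *v y))"
      using storage(1) cross(1) by (auto intro: continuous_on_minus)
    show "- storage (c *\<^sub>R y) (A *v (c *\<^sub>R y)) = c\<^sup>2 * - storage y (A *v y)"
      "- cross_form (c *\<^sub>R y) (A *v (c *\<^sub>R y)) = c\<^sup>2 * - cross_form y (A *v y)" for c y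
      by (simp_all add: storage(2) cross(2))
  next
    fix y :: "real^('n + 'n)"
    let ?x = "block_fst y" and ?w = "block_snd y"
    have nonneg: "0 \<le> (L *v ?x) \<bullet> (L *v ?x)" "0 \<le> m * (?x \<bullet> (L *v ?x))"
      using laplacian_nonneg[OF symmetric] m_pos by simp_all
    then show "0 \<le> - storage y (A *v y)"
      by (simp add: storage_rate)
    assume "y \<in> {y. invariant \<bullet> y = 0}" "y \<noteq> 0" "- storage y (A *v y) = 0"
    then have "m * (?x \<bullet> (L *v ?x)) = 0"
      using nonneg unfolding storage_rate by linarith
    with m_pos have "?x \<bullet> (L *v ?x) = 0"
      by simp
    then obtain c where x: "?x = c *\<^sub>R 1"
      by (rule laplacian_form_eq_0[OF graph])
    then have Lx: "L *v ?x = 0"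
      by (simp add: laplacian_const)
    have "m *\<^sub>R ?x + ?w \<noteq> 0"
    proof
      assume "m *\<^sub>R ?x + ?w = 0"
      then have "?w = - (m *\<^sub>R ?x)"
        by (simp add: eq_neg_iff_add_eq_0 add.commute)
      then have y: "y = c *\<^sub>R consensus"
        by (simp add: block_eq_iff x consensus_def linear_scale[OF linear_block_fst]
            linear_scale[OF linear_block_snd])
      with \<open>y \<in> _\<close> have "c = 0"
        using invariant_consensus by simp
      with y \<open>y \<noteq> 0\<close> show False by simp
    qed
    then show "0 < - cross_form y (A *v y)"
      by (simp add: cross_form_rate Lx)
  qed
  then show ?thesis
    by (rule eventually_mono) force
qed

lemma certificate:
  obtains h where "semistability_certificate A invariant consensus h"
proof -
  obtain \<alpha> where pos: "\<And>y. y \<noteq> 0 \<Longrightarrow> 0 < \<alpha> * storage y y + cross_form y y"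
    and decr: "\<And>y. invariant \<bullet> y = 0 \<Longrightarrow> y \<noteq> 0 \<Longrightarrow>
        \<alpha> * storage y (A *v y) + cross_form y (A *v y) < 0"
    using eventually_happens'[OF _ eventually_conj[OF storage_cross_form_pos storage_cross_form_decrease]]
    by auto
  have "semistability_certificate A invariant consensus (\<lambda>y z. \<alpha> * storage y z + cross_form y z)"
  proof
    show "bilinear (\<lambda>y z. \<alpha> * storage y z + cross_form y z)"
      using bilinear_storage bilinear_cross_form
      by (subst bilinear_def) (auto intro!: linearI simp: bilinear_ladd bilinear_radd
        bilinear_lmul bilinear_rmul algebra_simps)
  qed (use pos decr in \<open>simp_all add: consensus_equilibrium invariant_conserved invariant_consensus
      storage_sym cross_form_sym\<close>)
  then show ?thesis ..
qed

end

theorem mainTheorem1: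
  fixes E :: "'n::finite \<Rightarrow> 'n \<Rightarrow> bool" and k :: "'n \<Rightarrow> real" and m :: real
  assumes "connected_undirected_graph E"
    and "\<And>i. k i > 0"
    and "m > 0"
  shows "lyapunov_stable (error_matrix E k m) \<and>
    (\<forall>e0. \<exists>\<epsilon>::real. \<forall>e. linear_ode_solution (error_matrix E k m) e0 e \<longrightarrow>
      (e \<longlongrightarrow> \<epsilon> *\<^sub>R block_vector 1 (- m *\<^sub>R 1)) at_top)"
proof -
  interpret error_system E k m
    using assms by unfold_locales
  obtain h where "semistability_certificate A invariant consensus h"
    by (rule certificate)
  then interpret semistability_certificate A invariant consensus h .
  show ?thesis
    using lyapunov_stable solution_tendsto unfolding consensus_def by blast
qed

end
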